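(* There exists an instance with three agents $N=\{1,2,3\}$, a finite set of items $A$, and additive valuations with externalities $V_i(j,a)$ for which no complete allocation is EFX.
   Context: Setting: agents $N$, finite item set $A$. An allocation $\pi=(\pi_1,\dots,\pi_n)$ consists of pairwise disjoint bundles $\pi_i\subseteq A$; it is complete if the union is $A$. $\pi(a)$ is the agent receiving item $a$. $V_i(j,a)\in\mathbb{R}$ is the value agent $i$ gets when item $a$ is given to agent $j$, and $V_i(\pi)=\sum_{a\text{ assigned in }\pi}V_i(\pi(a),a)$. $\pi^{i\leftrightarrow j}$ denotes $\pi$ with the bundles of $i$ and $j$ swapped. Agent $i$ envies $j$ if $V_i(\pi^{i\leftrightarrow j})>V_i(\pi)$. An allocation $\pi$ is EFX if for all $i,j$ such that $i$ envies $j$, for every item $a\in A$, with $\lambda$ defined by $\lambda_\ell=\pi_\ell\setminus\{a\}$ for all $\ell$: whenever $V_i(\lambda)-V_i(\lambda^{i\leftrightarrow j})>V_i(\pi)-V_i(\pi^{i\leftrightarrow j})$, we have $V_i(\lambda)\ge V_i(\lambda^{i\leftrightarrow j})$. *)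

theory Defs
  imports Complex_Main
begin

definition allocation :: "'n set \<Rightarrow> 'a set \<Rightarrow> ('n \<Rightarrow> 'a set) \<Rightarrow> bool" where
  "allocation N A \<pi> \<longleftrightarrow> (\<forall>i\<in>N. \<pi> i \<subseteq> A) \<and>
     (\<forall>i\<in>N. \<forall>j\<in>N. i \<noteq> j \<longrightarrow> \<pi> i \<inter> \<pi> j = {})"

definition complete_alloc :: "'n set \<Rightarrow> 'a set \<Rightarrow> ('n \<Rightarrow> 'a set) \<Rightarrow> bool" where
  "complete_alloc N A \<pi> \<longleftrightarrow> (\<Union>i\<in>N. \<pi> i) = A"

(* V i j a : value to agent i when item a is given to agent j.
   V_i(pi) = sum over assigned items a of V i (pi(a)) a *)
definition val :: "'n set \<Rightarrow> ('n \<Rightarrow> 'n \<Rightarrow> 'a \<Rightarrow> real) \<Rightarrow> 'n \<Rightarrow> ('n \<Rightarrow> 'a set) \<Rightarrow> real" where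
  "val N V i \<pi> = (\<Sum>j\<in>N. \<Sum>a\<in>\<pi> j. V i j a)"

definition swap_bundles :: "('n \<Rightarrow> 'a set) \<Rightarrow> 'n \<Rightarrow> 'n \<Rightarrow> ('n \<Rightarrow> 'a set)" where
  "swap_bundles \<pi> i j = \<pi>(i := \<pi> j, j := \<pi> i)"

definition envies :: "'n set \<Rightarrow> ('n \<Rightarrow> 'n \<Rightarrow> 'a \<Rightarrow> real) \<Rightarrow> ('n \<Rightarrow> 'a set) \<Rightarrow> 'n \<Rightarrow> 'n \<Rightarrow> bool" where
  "envies N V \<pi> i j \<longleftrightarrow> val N V i (swap_bundles \<pi> i j) > val N V i \<pi>"

definition EFX :: "'n set \<Rightarrow> 'a set \<Rightarrow> ('n \<Rightarrow> 'n \<Rightarrow> 'a \<Rightarrow> real) \<Rightarrow> ('n \<Rightarrow> 'a set) \<Rightarrow> bool" where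
  "EFX N A V \<pi> \<longleftrightarrow> (\<forall>i\<in>N. \<forall>j\<in>N. envies N V \<pi> i j \<longrightarrow>
     (\<forall>a\<in>A. let lam = (\<lambda>l. \<pi> l - {a}) in
        val N V i lam - val N V i (swap_bundles lam i j) > val N V i \<pi> - val N V i (swap_bundles \<pi> i j)
        \<longrightarrow> val N V i lam \<ge> val N V i (swap_bundles lam i j)))"

end

theory Submission
  imports Defs
begin

text \<open>
  The counterexample has three items: two chores \<open>1\<close> and \<open>2\<close> which give every agent other than the
  owner the value \<open>1\<close> and \<open>2\<close>, respectively, and an item \<open>0\<close> which every agent likes most in the
  hands of its cyclic successor (value \<open>2\<close>) and least in the hands of its predecessor
  (value \<open>-1\<close>). If agent \<open>p\<close> owns item \<open>0\<close>, then \<open>p\<close> regards it as a chore of cost \<open>2\<close> towards its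
  successor \<open>q\<close>, while \<open>q\<close> regards it as a good of value \<open>1\<close> towards \<open>p\<close>. Up to rotation this leaves
  the nine ways to distribute the two chores. In all of them \<open>p\<close> towards \<open>q\<close>, or \<open>q\<close> towards \<open>p\<close>,
  or (when the third agent owns both chores) the third agent towards \<open>q\<close> violates EFX.
\<close>

text \<open>The share of item \<open>a\<close> in the change of \<open>i\<close>'s value when the
  swap with \<open>j\<close> is undone; a negative total means envy.\<close>

definition contrib :: "('n \<Rightarrow> 'n \<Rightarrow> 'a \<Rightarrow> real) \<Rightarrow> ('n \<Rightarrow> 'a set) \<Rightarrow> 'n \<Rightarrow> 'n \<Rightarrow> 'a \<Rightarrow> real" where
  "contrib V \<pi> i j a = (V i i a - V i j a) * (of_bool (a \<in> \<pi> i) - of_bool (a \<in> \<pi> j))"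

lemma val_diff_swap_bundles:
  assumes "finite N" "finite A" "i \<in> N" "j \<in> N" "i \<noteq> j" "\<pi> i \<subseteq> A" "\<pi> j \<subseteq> A"
  shows "val N V i \<pi> - val N V i (swap_bundles \<pi> i j) = (\<Sum>a\<in>A. contrib V \<pi> i j a)"
proof -
  have split: "val N V i \<rho> = sum (V i i) (\<rho> i) + sum (V i j) (\<rho> j)
      + (\<Sum>k\<in>N - {i} - {j}. sum (V i k) (\<rho> k))" for \<rho>
    unfolding val_def using assms
    by (simp add: sum.remove[of N i] sum.remove[of "N - {i}" j])
  \<comment> \<open>Indicators put the four bundle sums on the common index set \<open>A\<close>,
    where they merge termwise.\<close>
  have restrict: "sum f (\<pi> k) = (\<Sum>a\<in>A. f a * of_bool (a \<in> \<pi> k))"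
    if "\<pi> k \<subseteq> A" for f :: "'b \<Rightarrow> real" and k
    using that assms(2) by (intro sum.mono_neutral_cong_left) auto
  have "(\<Sum>k\<in>N - {i} - {j}. sum (V i k) (swap_bundles \<pi> i j k))
      = (\<Sum>k\<in>N - {i} - {j}. sum (V i k) (\<pi> k))"
    by (intro sum.cong) (auto simp: swap_bundles_def)
  then have "val N V i \<pi> - val N V i (swap_bundles \<pi> i j)
      = sum (V i i) (\<pi> i) + sum (V i j) (\<pi> j) - sum (V i i) (\<pi> j) - sum (V i j) (\<pi> i)"
    using assms(5) by (simp add: split swap_bundles_def)
  also have "\<dots> = (\<Sum>a\<in>A. contrib V \<pi> i j a)"
    using assms(6,7)
    by (simp add: restrict contrib_def algebra_simps flip: sum.distrib sum_subtractf)
  finally show ?thesis .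
qed

text \<open>Deleting \<open>a\<close> drops exactly its summand. As this is negative, the difference
  strictly rises, which is the premise that EFX puts on \<open>a\<close>.\<close>

lemma EFX_imp_contrib_nonneg:
  assumes "EFX N A V \<pi>" "finite N" "finite A" "allocation N A \<pi>"
    and ij: "i \<in> N" "j \<in> N" "i \<noteq> j"
    and "sum (contrib V \<pi> i j) A < 0" "a \<in> A" "contrib V \<pi> i j a < 0"
  shows "sum (contrib V \<pi> i j) (A - {a}) \<ge> 0"
proof -
  define lam where "lam = (\<lambda>l. \<pi> l - {a})"
  have sub: "\<pi> i \<subseteq> A" "\<pi> j \<subseteq> A"
    using assms by (auto simp: allocation_def)
  have diff: "val N V i \<pi> - val N V i (swap_bundles \<pi> i j) = sum (contrib V \<pi> i j) A"
    using assms sub by (intro val_diff_swap_bundles)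
  have "val N V i lam - val N V i (swap_bundles lam i j) = sum (contrib V lam i j) (A - {a})"
    using assms sub by (intro val_diff_swap_bundles) (auto simp: lam_def)
  also have "\<dots> = sum (contrib V \<pi> i j) (A - {a})"
    by (intro sum.cong) (auto simp: contrib_def lam_def)
  finally have diff': "val N V i lam - val N V i (swap_bundles lam i j)
      = sum (contrib V \<pi> i j) (A - {a})" .
  have "sum (contrib V \<pi> i j) A < sum (contrib V \<pi> i j) (A - {a})"
    using assms by (simp add: sum.remove)
  moreover have "envies N V \<pi> i j"
    using diff assms by (simp add: envies_def)
  ultimately have "val N V i lam \<ge> val N V i (swap_bundles lam i j)"
    using assms(1) ij \<open>a \<in> A\<close> diff diff' unfolding EFX_def Let_def lam_def by metis
  then show ?thesis
    using diff' by simp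
qed

definition cyclic_succ :: "nat \<Rightarrow> nat" where
  "cyclic_succ i = (if i = 3 then 1 else i + 1)"

definition cyclic_val :: "nat \<Rightarrow> nat \<Rightarrow> nat \<Rightarrow> real" where
  "cyclic_val i j a =
    (if j = i then 0 else if a = 0 then (if j = cyclic_succ i then 2 else -1) else real a)"

lemma cyclic_val_not_EFX:
  assumes alloc: "allocation {1,2,3} {0,1,2} \<pi>" and compl: "complete_alloc {1,2,3} {0,1,2} \<pi>"
  shows "\<not> EFX {1,2,3} {0,1,2} cyclic_val \<pi>"
proof
  assume efx: "EFX {1,2,3} {0,1,2} cyclic_val \<pi>"
  have owner: "\<exists>i\<in>{1,2,3}. a \<in> \<pi> i" if "a \<in> {0,1,2}" for a
    using compl that unfolding complete_alloc_def by blast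
  have unique: "a \<notin> \<pi> j" if "a \<in> \<pi> i" "i \<in> {1,2,3}" "j \<in> {1,2,3}" "i \<noteq> j" for a i j
    using alloc that unfolding allocation_def by blast
  obtain p where p: "p \<in> {1,2,3}" "0 \<in> \<pi> p"
    using owner[of 0] by auto
  define q where "q = cyclic_succ p"
  define r where "r = cyclic_succ q"
  \<comment> \<open>The only case split on \<open>p\<close>; from here on the cyclic symmetry lets
    all three rotations be treated at once.\<close>
  have N: "{1,2,3} = {p,q,r}" and ne: "p \<noteq> q" "q \<noteq> r" "p \<noteq> r" and rp: "cyclic_succ r = p"
    using p(1) by (auto simp: q_def r_def cyclic_succ_def)
  note ne = ne ne[symmetric]
  have "0 \<notin> \<pi> q" "0 \<notin> \<pi> r"
    using unique p(2) N ne by blast+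
  note item0 = p(2) this
  have items: "(a \<in> \<pi> p \<and> a \<notin> \<pi> q \<and> a \<notin> \<pi> r) \<or> (a \<notin> \<pi> p \<and> a \<in> \<pi> q \<and> a \<notin> \<pi> r)
      \<or> (a \<notin> \<pi> p \<and> a \<notin> \<pi> q \<and> a \<in> \<pi> r)" if "a \<in> {1,2}" for a
    using owner[of a] unique[of a] that N ne by (metis insert_iff singletonD)
  have val: "cyclic_val p p a = 0" "cyclic_val q q a = 0" "cyclic_val r r a = 0"
    "cyclic_val p q a = (if a = 0 then 2 else real a)"
    "cyclic_val q p a = (if a = 0 then -1 else real a)"
    "cyclic_val r q a = (if a = 0 then -1 else real a)" for a
    using ne rp by (auto simp: cyclic_val_def q_def[symmetric] r_def[symmetric])
  have efx_on: "sum (contrib cyclic_val \<pi> i j) ({0,1,2} - {a}) \<ge> 0"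
    if "i \<in> {p,q,r}" "j \<in> {p,q,r}" "i \<noteq> j" "sum (contrib cyclic_val \<pi> i j) {0,1,2} < 0"
      "a \<in> {0,1,2}" "contrib cyclic_val \<pi> i j a < 0" for i j a
    using EFX_imp_contrib_nonneg[OF efx _ _ alloc] that unfolding N by simp
  have "{0,1,2} - {0} = {1,2::nat}" "{0,1,2} - {1} = {0,2::nat}" "{0,1,2} - {2} = {0,1::nat}"
    by auto
  note removals = this
  \<comment> \<open>Deleting 0 leaves \<open>p\<close> envying \<open>q\<close> if \<open>p\<close>
    owns 2, or owns 1 while \<open>r\<close> owns 2. With \<open>p\<close> and \<open>q\<close>
    exchanged, the same holds. If \<open>r\<close> owns both chores, deleting 1 leaves
    \<open>r\<close> envying \<open>q\<close>.\<close>
  show False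
    using items[of 1] items[of 2] item0 ne
      efx_on[of p q 0] efx_on[of p q 1] efx_on[of q p 0] efx_on[of q p 1] efx_on[of r q 1]
    unfolding removals by (auto simp: contrib_def val)
qed

theorem theorem2:
  shows "\<exists>(A :: nat set) (V :: nat \<Rightarrow> nat \<Rightarrow> nat \<Rightarrow> real). finite A \<and>
    (\<forall>\<pi> :: nat \<Rightarrow> nat set. allocation {1,2,3} A \<pi> \<and> complete_alloc {1,2,3} A \<pi>
        \<longrightarrow> \<not> EFX {1,2,3} A V \<pi>)"
  using cyclic_val_not_EFX by (intro exI[of _ "{0,1,2}"] exI[of _ cyclic_val]) auto

end
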